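(* There exists a sequence $\{a_n\}_{n\in\mathbb{Z}_+}$ in $\mathbb{C}$ such that for each $f\in C(\mathbb{T})$ there is a strictly increasing sequence $\{n_k\}_{k\in\mathbb{Z}_+}$ of positive integers for which $\sum_{j=0}^{n_k} a_j z^j$ converges to $f(z)$ as $k\to\infty$ for all $z\in\mathbb{T}$.
   Context: $\mathbb{T}=\{z\in\mathbb{C}:|z|=1\}$; $\mathbb{Z}_+$ is the set of non-negative integers; $C(\mathbb{T})$ is the space of continuous complex-valued functions on $\mathbb{T}$. *)

theory Defs
  imports "HOL-Analysis.Analysis"
begin

end

theory Submission
  imports Defs
begin

text \<open>
  On a compact proper subset \<open>K\<close> of the circle, every continuous function is a uniform limit of
  polynomials in \<open>z\<close>: there is a polynomial \<open>p\<close> with \<open>p(0) = 1\<close> and \<open>|p| < 1\<close> on \<open>K\<close>, so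
  \<open>(1 - p(z)^n)/z\<close> is a polynomial converging to \<open>1/z = cnj z\<close> on \<open>K\<close>, and Stone-Weierstrass
  applies. Dividing by \<open>z^(m+1)\<close> first, any polynomial can thus be continued by terms of degree
  greater than \<open>m\<close> so as to approximate a prescribed function on \<open>K\<close>. Such continuations are
  performed successively on circles with a gap removed, once for each pair of a gap and a target
  from a countable dense set of polynomials. The gaps are chosen such that each point of the circle
  lies in only finitely many of them; this turns the uniform approximation off the gaps into
  pointwise convergence everywhere.
\<close>

section \<open>Peak polynomials off a point of the circle\<close>

text \<open>
  The polynomial is a truncation of the power series of \<open>(1 - t w)/(1 - r w)\<close>, where
  \<open>w = cnj u * z\<close> and \<open>0 < t < r < 1\<close>: for \<open>|w| = 1\<close> this quotient has modulus less than 1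
  exactly if \<open>2 * Re w < r + t\<close>.
\<close>

lemma peak_polynomial:
  fixes K :: "complex set" and u :: complex
  assumes "compact K" "K \<subseteq> sphere 0 1" "norm u = 1" "u \<notin> K"
  obtains p where "poly p 0 = 1" "\<And>z. z \<in> K \<Longrightarrow> norm (poly p z) < 1"
proof (cases "K = {}")
  case True
  then show ?thesis using that[of 1] by simp
next
  case False
  have norm_rot: "norm (cnj u * z) = 1" if "z \<in> K" for z
    using that assms by (auto simp: norm_mult)
  have "continuous_on K (\<lambda>z. Re (cnj u * z))"
    by (intro continuous_intros)
  then obtain z0 where z0: "z0 \<in> K" "\<And>z. z \<in> K \<Longrightarrow> Re (cnj u * z) \<le> Re (cnj u * z0)"
    using continuous_attains_sup[OF \<open>compact K\<close> False] by metis
  define w0 where "w0 = cnj u * z0"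
  have "w0 \<noteq> 1"
  proof
    assume "w0 = 1"
    then have "u * (cnj u * z0) = u" by (simp add: w0_def)
    moreover have "u * cnj u = 1" using assms(3) by (simp add: complex_norm_square[symmetric])
    ultimately have "z0 = u" by (simp add: mult.assoc[symmetric])
    then show False using z0 assms by simp
  qed
  have "Re w0 < 1"
  proof -
    have n: "norm w0 = 1" using norm_rot[OF z0(1)] by (simp add: w0_def)
    have "Re w0 \<le> 1" using complex_Re_le_cmod[of w0] n by simp
    moreover have "Re w0 \<noteq> 1"
    proof
      assume "Re w0 = 1"
      then have "Im w0 = 0" using n cmod_power2[of w0] by simp
      then show False using \<open>w0 \<noteq> 1\<close> \<open>Re w0 = 1\<close> by (simp add: complex_eq_iff)
    qed
    ultimately show ?thesis by simp
  qed
  \<comment> \<open>\<open>Re w0\<close> bounds the real parts of the rotated \<open>K\<close> and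
    stays below 1 because \<open>u\<close> is missing. With \<open>t\<close> above it and
    \<open>r > t\<close>, \<open>2 * Re w < 2 * t < r + t\<close>.\<close>
  then obtain t where t: "max 0 (Re w0) < t" "t < 1"
    using dense[of "max 0 (Re w0)" 1] by auto
  define r where "r = (t + 1) / 2"
  have r: "t < r" "r < 1" "0 < r" using t by (auto simp: r_def)
  let ?\<phi> = "\<lambda>z. norm (1 - t * (cnj u * z)) / norm (1 - r * (cnj u * z))"
  have nz: "1 - r * (cnj u * z) \<noteq> 0" if "z \<in> K" for z
  proof
    assume "1 - r * (cnj u * z) = 0"
    then have "norm (r * (cnj u * z)) = 1" by (metis eq_iff_diff_eq_0 norm_one)
    then show False using norm_rot[OF that] r by (simp only: norm_mult norm_of_real)
  qed
  have \<phi>_less: "?\<phi> z < 1" if "z \<in> K" for z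
  proof -
    define w where "w = cnj u * z"
    have n: "(Re w)\<^sup>2 + (Im w)\<^sup>2 = 1"
      using norm_rot[OF that] cmod_power2[of w] by (simp add: w_def)
    have sq: "(norm (1 - of_real s * w))\<^sup>2 = 1 + s\<^sup>2 - 2 * s * Re w" for s
    proof -
      have "(norm (1 - of_real s * w))\<^sup>2 = 1 - 2 * s * Re w + s\<^sup>2 * ((Re w)\<^sup>2 + (Im w)\<^sup>2)"
        unfolding cmod_power2 by (simp add: power2_eq_square algebra_simps)
      then show ?thesis using n by simp
    qed
    have "Re w < t" using z0(2)[OF that] t by (simp add: w_def w0_def)
    then have "2 * Re w < r + t" using r by simp
    then have "(r - t) * (2 * Re w) < (r - t) * (r + t)"
      using r by (intro mult_strict_left_mono) auto
    then have "(norm (1 - t * w))\<^sup>2 < (norm (1 - r * w))\<^sup>2"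
      unfolding sq by (simp add: algebra_simps power2_eq_square)
    then have "norm (1 - t * w) < norm (1 - r * w)"
      by (rule power2_less_imp_less) simp
    then show ?thesis using nz[OF that] by (simp add: w_def)
  qed
  have "continuous_on K ?\<phi>"
    by (intro continuous_intros) (use nz in simp)
  from continuous_attains_sup[OF \<open>compact K\<close> False this]
  obtain z1 where z1: "z1 \<in> K" "\<And>z. z \<in> K \<Longrightarrow> ?\<phi> z \<le> ?\<phi> z1"
    by blast
  define \<rho> where "\<rho> = ?\<phi> z1"
  \<comment> \<open>Truncating the geometric series after \<open>N\<close> terms multiplies the
    quotient by \<open>1 - (r * w) ^ N\<close>, of modulus at most \<open>1 + r ^ N\<close>. As
    \<open>\<rho> < 1\<close>, a large \<open>N\<close> absorbs this factor.\<close>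
  have "(\<lambda>N. \<rho> * (1 + r ^ N)) \<longlonglongrightarrow> \<rho> * (1 + 0)"
    using r by (intro tendsto_intros LIMSEQ_power_zero) auto
  then have "\<forall>\<^sub>F N in sequentially. \<rho> * (1 + r ^ N) < 1"
    using \<phi>_less[OF z1(1)] by (intro order_tendstoD(2)) (auto simp: \<rho>_def)
  then obtain N0 where N0: "\<And>N. N \<ge> N0 \<Longrightarrow> \<rho> * (1 + r ^ N) < 1"
    by (auto simp: eventually_sequentially)
  define N where "N = Suc N0"
  define p where "p = [:1, - (t * cnj u):] * (\<Sum>j<N. monom ((r * cnj u) ^ j) j)"
  have p_eq: "poly p z = (1 - t * (cnj u * z)) * (\<Sum>j<N. (r * (cnj u * z)) ^ j)" for z
    by (simp add: p_def poly_sum poly_monom power_mult_distrib algebra_simps)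
  show ?thesis
  proof (rule that)
    \<comment> \<open>\<open>N\<close> is a successor, so the sum contains the term
      \<open>0 ^ 0 = 1\<close>.\<close>
    have "(\<Sum>j<N. (0::complex) ^ j) = 1"
      by (simp add: N_def sum.lessThan_Suc_shift del: sum.lessThan_Suc)
    then show "poly p 0 = 1" by (simp add: p_eq)
  next
    fix z assume z: "z \<in> K"
    let ?w = "r * (cnj u * z)"
    have "poly p z * (1 - ?w) = (1 - t * (cnj u * z)) * (1 - ?w ^ N)"
      unfolding p_eq one_diff_power_eq by (simp add: mult_ac)
    then have "norm (poly p z) * norm (1 - ?w) = norm (1 - t * (cnj u * z)) * norm (1 - ?w ^ N)"
      by (simp only: flip: norm_mult)
    then have "norm (poly p z) = ?\<phi> z * norm (1 - ?w ^ N)"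
      using nz[OF z] by (simp only: times_divide_eq_left eq_divide_eq norm_eq_zero) simp
    also have "\<dots> \<le> \<rho> * (1 + r ^ N)"
    proof (rule mult_mono)
      have "norm (1 - ?w ^ N) \<le> norm (1::complex) + norm (?w ^ N)"
        by (rule norm_triangle_ineq4)
      also have "norm (?w ^ N) = r ^ N"
        using norm_rot[OF z] r by (simp only: norm_power norm_mult[of "of_real r"] norm_of_real) simp
      finally show "norm (1 - ?w ^ N) \<le> 1 + r ^ N" by simp
    qed (use z1(2)[OF z] in \<open>auto simp: \<rho>_def\<close>)
    also have "\<dots> < 1" by (rule N0) (simp add: N_def)
    finally show "norm (poly p z) < 1" .
  qed
qed

section \<open>Uniform approximation by polynomials on compact proper subsets of the circle\<close>

definition poly_approximable :: "complex set \<Rightarrow> (complex \<Rightarrow> complex) \<Rightarrow> bool" where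
  "poly_approximable K f \<longleftrightarrow> (\<forall>e>0. \<exists>p. \<forall>z\<in>K. norm (f z - poly p z) < e)"

lemma poly_approximable_poly: "poly_approximable K (poly p)"
  unfolding poly_approximable_def by (auto intro!: exI[of _ p])

text \<open>Serves to replace a factor of a product by a polynomial, and later to pass from
  polynomial functions of the real and imaginary parts to all continuous functions.\<close>

lemma poly_approximable_closed:
  assumes "\<And>e. e > 0 \<Longrightarrow> \<exists>g. poly_approximable K g \<and> (\<forall>z\<in>K. norm (f z - g z) < e)"
  shows "poly_approximable K f"
  unfolding poly_approximable_def
proof (intro allI impI)
  fix e :: real assume "e > 0"
  then obtain g where g: "poly_approximable K g" "\<forall>z\<in>K. norm (f z - g z) < e / 2"
    using assms[of "e / 2"] by auto
  then obtain p where p: "\<forall>z\<in>K. norm (g z - poly p z) < e / 2"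
    using \<open>e > 0\<close> unfolding poly_approximable_def by (meson half_gt_zero)
  have "norm (f z - poly p z) < e" if "z \<in> K" for z
    using norm_triangle_lt[of "f z - g z" "g z - poly p z" e] g(2) p that by force
  then show "\<exists>p. \<forall>z\<in>K. norm (f z - poly p z) < e" by blast
qed

lemma poly_approximable_add:
  assumes "poly_approximable K f" "poly_approximable K g"
  shows "poly_approximable K (\<lambda>z. f z + g z)"
  unfolding poly_approximable_def
proof (intro allI impI)
  fix e :: real assume "e > 0"
  then obtain p q where pq: "\<forall>z\<in>K. norm (f z - poly p z) < e / 2" "\<forall>z\<in>K. norm (g z - poly q z) < e / 2"
    using assms unfolding poly_approximable_def by (meson half_gt_zero)
  have "norm (f z + g z - poly (p + q) z) < e" if "z \<in> K" for z
    using norm_triangle_lt[of "f z - poly p z" "g z - poly q z" e] pq that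
    by (force simp: algebra_simps)
  then show "\<exists>p. \<forall>z\<in>K. norm (f z + g z - poly p z) < e" by blast
qed

lemma poly_approximable_poly_mult:
  assumes "poly_approximable K f" "compact K"
  shows "poly_approximable K (\<lambda>z. poly p z * f z)"
  unfolding poly_approximable_def
proof (intro allI impI)
  fix e :: real assume "e > 0"
  have "bounded (poly p ` K)"
    using assms by (intro compact_imp_bounded compact_continuous_image continuous_intros)
  then obtain B where B: "B > 0" "\<And>z. z \<in> K \<Longrightarrow> norm (poly p z) \<le> B"
    by (auto simp: bounded_pos)
  obtain q where q: "\<forall>z\<in>K. norm (f z - poly q z) < e / B"
    using assms(1) \<open>e > 0\<close> B(1) unfolding poly_approximable_def by (meson divide_pos_pos)
  have "norm (poly p z * f z - poly (p * q) z) < e" if "z \<in> K" for z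
  proof -
    have "norm (poly p z * f z - poly (p * q) z) = norm (poly p z) * norm (f z - poly q z)"
      by (simp add: algebra_simps flip: norm_mult)
    also have "\<dots> \<le> B * norm (f z - poly q z)"
      using B(2)[OF that] by (intro mult_right_mono) auto
    also have "\<dots> < e" using q that B(1) by (simp add: field_simps)
    finally show ?thesis .
  qed
  then show "\<exists>p'. \<forall>z\<in>K. norm (poly p z * f z - poly p' z) < e" by blast
qed

lemma poly_approximable_mult:
  assumes "poly_approximable K f" "poly_approximable K g" "compact K" "continuous_on K g"
  shows "poly_approximable K (\<lambda>z. f z * g z)"
proof (rule poly_approximable_closed)
  fix e :: real assume "e > 0"
  have "bounded (g ` K)"
    using assms by (intro compact_imp_bounded compact_continuous_image)
  then obtain B where B: "B > 0" "\<And>z. z \<in> K \<Longrightarrow> norm (g z) \<le> B"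
    by (auto simp: bounded_pos)
  obtain p where p: "\<forall>z\<in>K. norm (f z - poly p z) < e / B"
    using assms(1) \<open>e > 0\<close> B(1) unfolding poly_approximable_def by (meson divide_pos_pos)
  have "norm (f z * g z - poly p z * g z) < e" if "z \<in> K" for z
  proof -
    have "norm (f z * g z - poly p z * g z) = norm (f z - poly p z) * norm (g z)"
      by (simp add: algebra_simps flip: norm_mult)
    also have "\<dots> \<le> norm (f z - poly p z) * B"
      using B(2)[OF that] by (intro mult_left_mono) auto
    also have "\<dots> < e" using p that B(1) by (simp add: field_simps)
    finally show ?thesis .
  qed
  then show "\<exists>h. poly_approximable K h \<and> (\<forall>z\<in>K. norm (f z * g z - h z) < e)"
    using poly_approximable_poly_mult[OF assms(2,3)] by blast
qed

text \<open>The missing point is essential: on the whole circle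
  \<open>z * (cnj z - poly q z)\<close> has mean 1 for every \<open>q\<close>, so the error could
  not drop below 1.\<close>

lemma poly_approximable_cnj:
  assumes "compact K" "K \<subset> sphere 0 1"
  shows "poly_approximable K cnj"
proof (cases "K = {}")
  case True
  then show ?thesis by (simp add: poly_approximable_def)
next
  case False
  obtain u where "norm u = 1" "u \<notin> K" using assms(2) unfolding psubset_eq by fastforce
  then obtain p where p: "poly p 0 = 1" "\<And>z. z \<in> K \<Longrightarrow> norm (poly p z) < 1"
    using peak_polynomial[OF assms(1)] assms(2) by blast
  have "continuous_on K (\<lambda>z. norm (poly p z))" by (intro continuous_intros)
  then obtain z0 where z0: "z0 \<in> K" "\<And>z. z \<in> K \<Longrightarrow> norm (poly p z) \<le> norm (poly p z0)"
    using continuous_attains_sup[OF \<open>compact K\<close> False] by metis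
  show ?thesis
    unfolding poly_approximable_def
  proof (intro allI impI)
    fix e :: real assume "e > 0"
    \<comment> \<open>The maximum of the modulus over \<open>K\<close> is attained at
      \<open>z0\<close> and is below 1, so one exponent works for all of \<open>K\<close>.\<close>
    obtain n where n: "norm (poly p z0) ^ n < e"
      using real_arch_pow_inv[OF \<open>e > 0\<close> p(2)[OF z0(1)]] by blast
    have "poly (1 - p ^ n) 0 = 0" by (simp add: p(1))
    then obtain q where q: "1 - p ^ n = [:0, 1:] * q"
      unfolding poly_eq_0_iff_dvd by (auto simp: dvd_def)
    have "norm (cnj z - poly q z) < e" if "z \<in> K" for z
    proof -
      have nz: "norm z = 1" using that assms(2) by auto
      then have zz: "z * cnj z = 1" by (simp add: complex_norm_square[symmetric])
      have "1 - poly p z ^ n = z * poly q z"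
        using arg_cong[OF q, of "\<lambda>p. poly p z"] by simp
      then have "z * (cnj z - poly q z) = poly p z ^ n"
        using zz by (simp add: algebra_simps)
      then have "norm (cnj z - poly q z) = norm (poly p z) ^ n"
        using nz by (metis mult_1 norm_mult norm_power)
      also have "\<dots> \<le> norm (poly p z0) ^ n"
        using z0(2)[OF that] by (intro power_mono) auto
      finally show ?thesis using n by simp
    qed
    then show "\<exists>p. \<forall>z\<in>K. norm (cnj z - poly p z) < e" by blast
  qed
qed

lemma poly_approximable_real_polynomial_function:
  assumes K: "compact K" "K \<subset> sphere 0 1" and "real_polynomial_function f"
  shows "poly_approximable K (\<lambda>z. complex_of_real (f z))"
  using assms(3)
proof induction
  case (linear f)
  then interpret bounded_linear f .
  \<comment> \<open>Substitute \<open>Re z = (z + cnj z) / 2\<close> and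
    \<open>Im z = (z - cnj z) / (2 * \<i>)\<close> into
    \<open>Re z * f 1 + Im z * f \<i>\<close>.\<close>
  have f_eq: "complex_of_real (f z) =
      poly [:0, (f 1 - \<i> * f \<i>) / 2:] z + poly [:(f 1 + \<i> * f \<i>) / 2:] z * cnj z" for z
  proof -
    have "z = Re z *\<^sub>R 1 + Im z *\<^sub>R \<i>" by (simp add: complex_eq_iff)
    then have "f z = Re z * f 1 + Im z * f \<i>"
      by (metis add scaleR real_scaleR_def)
    then show ?thesis by (simp add: complex_eq_iff field_simps)
  qed
  have "poly_approximable K (\<lambda>z.
      poly [:0, (f 1 - \<i> * f \<i>) / 2:] z + poly [:(f 1 + \<i> * f \<i>) / 2:] z * cnj z)"
    using K by (intro poly_approximable_add poly_approximable_poly poly_approximable_poly_mult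
        poly_approximable_cnj)
  then show ?case by (simp only: f_eq[symmetric])
next
  case (const c)
  have "poly [:of_real c:] = (\<lambda>z::complex. complex_of_real c)" by auto
  then show ?case using poly_approximable_poly by metis
next
  case (add f g)
  then show ?case by (simp add: poly_approximable_add)
next
  case (mult f g)
  then have "continuous_on K (\<lambda>z. complex_of_real (g z))"
    by (intro continuous_intros continuous_on_polymonial_function) (simp add: real_polynomial_function_eq)
  then show ?case using mult.IH K by (simp add: poly_approximable_mult)
qed

text \<open>Despite the name, \<open>K\<close> need not be an arc. Real Stone-Weierstrass reduces
  \<open>f\<close> to polynomial functions of the real and imaginary parts, which are built from
  \<open>z\<close> and \<open>cnj z\<close>.\<close>

lemma poly_approximable_continuous_on_arc:
  assumes K: "compact K" "K \<subset> sphere 0 1" and f: "continuous_on K f"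
  shows "poly_approximable K f"
proof (rule poly_approximable_closed)
  fix e :: real assume "e > 0"
  from Stone_Weierstrass_polynomial_function[OF K(1) f this]
  obtain g where g: "polynomial_function g" "\<And>z. z \<in> K \<Longrightarrow> norm (f z - g z) < e"
    by blast
  have "real_polynomial_function (\<lambda>z. Re (g z))" "real_polynomial_function (\<lambda>z. Im (g z))"
    using g(1) bounded_linear_Re bounded_linear_Im by (auto simp: polynomial_function_def o_def)
  then have "poly_approximable K (\<lambda>z. of_real (Re (g z)) + poly [:\<i>:] z * of_real (Im (g z)))"
    using K by (intro poly_approximable_add poly_approximable_poly_mult
        poly_approximable_real_polynomial_function)
  then have "poly_approximable K g" by (simp flip: complex_eq)
  then show "\<exists>g. poly_approximable K g \<and> (\<forall>z\<in>K. norm (f z - g z) < e)" using g(2) by blast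
qed

section \<open>Countably many targets, continuation of polynomials, and gaps\<close>

text \<open>Coefficients are moved into a countable dense set one at a time. In Horner form the tail
  is multiplied by \<open>z\<close> with modulus at most 1, so head and tail may each take half of
  the error.\<close>

lemma polynomials_separable:
  obtains q :: "nat \<Rightarrow> complex poly" where
    "\<And>p e. e > 0 \<Longrightarrow> \<exists>j. \<forall>z\<in>cball 0 1. norm (poly p z - poly (q j) z) < e"
proof -
  obtain D :: "complex set" where D: "countable D" "\<And>X. open X \<Longrightarrow> X \<noteq> {} \<Longrightarrow> \<exists>d\<in>D. d \<in> X"
    using countable_dense_setE by metis
  have approx: "\<exists>xs\<in>lists D. \<forall>z\<in>cball 0 1. norm (poly p z - poly (Poly xs) z) < e" if "e > 0" for p e
    using that
  proof (induction p arbitrary: e)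
    case 0
    then show ?case by (intro bexI[of _ "[]"]) auto
  next
    case (pCons a p)
    from pCons.IH[OF half_gt_zero[OF pCons.prems]]
    obtain xs where xs: "xs \<in> lists D" "\<And>z. z \<in> cball 0 1 \<Longrightarrow> norm (poly p z - poly (Poly xs) z) < e / 2"
      by blast
    obtain d where d: "d \<in> D" "norm (a - d) < e / 2"
      using D(2)[of "ball a (e / 2)"] pCons.prems by (auto simp: dist_norm)
    have "norm (poly (pCons a p) z - poly (Poly (d # xs)) z) < e" if z: "z \<in> cball 0 1" for z
    proof -
      have "norm (z * (poly p z - poly (Poly xs) z)) \<le> 1 * norm (poly p z - poly (Poly xs) z)"
        unfolding norm_mult using z by (intro mult_right_mono) auto
      then have "norm (z * (poly p z - poly (Poly xs) z)) < e / 2" using xs(2)[OF z] by simp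
      then have "norm ((a - d) + z * (poly p z - poly (Poly xs) z)) < e"
        using d(2) by (intro norm_triangle_lt) simp
      then show ?thesis by (simp add: algebra_simps)
    qed
    then show ?case using xs(1) d(1) by (intro bexI[of _ "d # xs"]) auto
  qed
  show ?thesis
  proof (rule that)
    fix p :: "complex poly" and e :: real assume "e > 0"
    then obtain xs where xs: "xs \<in> lists D" "\<forall>z\<in>cball 0 1. norm (poly p z - poly (Poly xs) z) < e"
      using approx by blast
    then have "\<exists>j. from_nat_into (lists D) j = xs"
      using countable_lists[OF D(1)] from_nat_into_surj by metis
    then show "\<exists>j. \<forall>z\<in>cball 0 1. norm (poly p z - poly (Poly (from_nat_into (lists D) j)) z) < e"
      using xs(2) by metis
  qed
qed

text \<open>Multiplying an approximation of \<open>(f - P) / z ^ Suc m\<close> back by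
  \<open>z ^ Suc m\<close> touches only coefficients beyond \<open>m\<close>, and preserves the
  error since \<open>norm z = 1\<close> on \<open>K\<close>.\<close>

lemma extend_poly_approximately:
  fixes P :: "complex poly"
  assumes K: "compact K" "K \<subset> sphere 0 1" and f: "continuous_on K f" and "e > 0"
  obtains Q where "\<And>i. i \<le> m \<Longrightarrow> coeff Q i = coeff P i" "\<And>z. z \<in> K \<Longrightarrow> norm (poly Q z - f z) < e"
proof -
  have norm1: "norm z = 1" if "z \<in> K" for z using K(2) that by auto
  have "continuous_on K (\<lambda>z. (f z - poly P z) / z ^ Suc m)"
    using norm1 f by (intro continuous_intros) force+
  then obtain r where r: "\<And>z. z \<in> K \<Longrightarrow> norm ((f z - poly P z) / z ^ Suc m - poly r z) < e"
    using poly_approximable_continuous_on_arc[OF K] \<open>e > 0\<close> unfolding poly_approximable_def by blast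
  show ?thesis
  proof (rule that)
    show "coeff (P + monom 1 (Suc m) * r) i = coeff P i" if "i \<le> m" for i
      using that by (simp add: coeff_monom_mult)
  next
    fix z assume z: "z \<in> K"
    have nz: "z \<noteq> 0" using norm1[OF z] by auto
    have "poly (P + monom 1 (Suc m) * r) z - f z
        = - (z ^ Suc m * ((f z - poly P z) / z ^ Suc m - poly r z))"
      using nz by (simp add: poly_monom field_simps)
    also have "norm \<dots> = norm ((f z - poly P z) / z ^ Suc m - poly r z)"
      using norm1[OF z] by (simp only: norm_minus_cancel norm_mult norm_power) simp
    finally show "norm (poly (P + monom 1 (Suc m) * r) z - f z) < e" using r[OF z] by simp
  qed
qed

lemma shrinking_gaps:
  obtains K :: "nat \<Rightarrow> complex set" where
    "\<And>i. compact (K i)" "\<And>i. K i \<subset> sphere 0 1"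
    "\<And>z. z \<in> sphere 0 1 \<Longrightarrow> \<forall>\<^sub>F i in sequentially. z \<in> K i"
proof -
  \<comment> \<open>The gaps shrink to the point 1 but never contain it.\<close>
  define u where "u i = cis (1 / Suc i)" for i
  define K where "K i = sphere 0 1 - ball (u i) (dist (u i) 1 / 2)" for i
  \<comment> \<open>This makes the radius positive, so the centre \<open>u i\<close> lies in its own
    gap and \<open>K i\<close> is a proper subset.\<close>
  have u_ne: "u i \<noteq> 1" for i
  proof
    assume "u i = 1"
    then have "sin (1 / Suc i) = 0" by (simp add: u_def complex_eq_iff)
    moreover have "sin (1 / Suc i) > 0"
    proof (rule sin_gt_zero)
      have "1 / real (Suc i) \<le> 1" by simp
      then show "1 / real (Suc i) < pi" using pi_gt3 by linarith
    qed simp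
    ultimately show False by simp
  qed
  have "(\<lambda>i. cis (1 / Suc i)) \<longlonglongrightarrow> cis 0"
    using LIMSEQ_inverse_real_of_nat by (intro tendsto_cis) (simp add: inverse_eq_divide)
  then have u_lim: "u \<longlonglongrightarrow> 1" by (simp add: u_def[abs_def])
  show ?thesis
  proof (rule that)
    show "compact (K i)" for i by (simp add: K_def compact_diff)
    show "K i \<subset> sphere 0 1" for i
    proof -
      have "u i \<in> sphere 0 1" by (simp add: u_def)
      moreover have "u i \<notin> K i" using u_ne[of i] by (simp add: K_def)
      moreover have "K i \<subseteq> sphere 0 1" by (auto simp: K_def)
      ultimately show ?thesis by blast
    qed
  next
    fix z :: complex assume z: "z \<in> sphere 0 1"
    show "\<forall>\<^sub>F i in sequentially. z \<in> K i"
    proof (cases "z = 1")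
      case True
      then show ?thesis by (simp add: K_def dist_commute)
    next
      case False
      \<comment> \<open>The distance from the centres to \<open>z\<close> tends to
        \<open>dist 1 z > 0\<close>, while the radii tend to 0.\<close>
      have "(\<lambda>i. dist (u i) z - dist (u i) 1 / 2) \<longlonglongrightarrow> dist 1 z - dist (1::complex) 1 / 2"
        by (intro tendsto_intros u_lim) simp
      then have "\<forall>\<^sub>F i in sequentially. 0 < dist (u i) z - dist (u i) 1 / 2"
        using False by (intro order_tendstoD(1)) auto
      then show ?thesis
        by eventually_elim (use z in \<open>auto simp: K_def\<close>)
    qed
  qed
qed

section \<open>Construction of the coefficients and choice of the subsequence\<close>

theorem proposition1p3:
  shows "\<exists>a :: nat \<Rightarrow> complex.
    \<forall>f :: complex \<Rightarrow> complex. continuous_on (sphere 0 1) f \<longrightarrow>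
      (\<exists>n :: nat \<Rightarrow> nat. strict_mono n \<and> (\<forall>k. 0 < n k) \<and>
        (\<forall>z \<in> sphere 0 1. (\<lambda>k. \<Sum>j=0..n k. a j * z ^ j) \<longlonglongrightarrow> f z))"
proof -
  obtain K :: "nat \<Rightarrow> complex set" where
    K: "\<And>i. compact (K i)" "\<And>i. K i \<subset> sphere 0 1"
      "\<And>z. z \<in> sphere 0 1 \<Longrightarrow> \<forall>\<^sub>F i in sequentially. z \<in> K i"
    using shrinking_gaps by blast
  obtain q :: "nat \<Rightarrow> complex poly" where
    q: "\<And>p e. e > 0 \<Longrightarrow> \<exists>j. \<forall>z\<in>cball 0 1. norm (poly p z - poly (q j) z) < e"
    using polynomials_separable by blast
  \<comment> \<open>Stage \<open>k\<close> treats the pair (gap, target) coded by \<open>k\<close>;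
    every pair is the code of some stage.\<close>
  define gap where "gap k = fst (prod_decode k)" for k
  define target where "target k = q (snd (prod_decode k))" for k
  define good where "good k P \<longleftrightarrow>
    (\<forall>z\<in>K (gap k). norm (poly P z - poly (target k) z) < 1 / Suc k)" for k P
  have extend: "\<exists>Q. (\<forall>i\<le>m. coeff Q i = coeff P i) \<and> good k Q" for k m P
  proof -
    have "continuous_on (K (gap k)) (poly (target k))" by (intro continuous_intros)
    from extend_poly_approximately[OF K(1,2) this, of "1 / Suc k" m P]
    show ?thesis unfolding good_def by (metis of_nat_0_less_iff zero_less_Suc zero_less_divide_1_iff)
  qed
  \<comment> \<open>A state is a polynomial with a cutoff at least its degree. Coefficients up to
    the cutoff are frozen at the next stage. Cutoffs become the indices of the partial sums, hence
    positive and increasing.\<close>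
  have "\<exists>s. \<forall>k. (degree (fst (s k)) \<le> snd (s k) \<and> 0 < snd (s k) \<and> good k (fst (s k))) \<and>
      (snd (s k) < snd (s (Suc k)) \<and> (\<forall>i\<le>snd (s k). coeff (fst (s (Suc k))) i = coeff (fst (s k)) i))"
  proof (rule dependent_nat_choice)
    obtain Q where "good 0 Q"
      using extend by blast
    then show "\<exists>s. degree (fst s) \<le> snd s \<and> 0 < snd s \<and> good 0 (fst s)"
      by (intro exI[of _ "(Q, Suc (degree Q))"]) simp
  next
    fix s :: "complex poly \<times> nat" and k
    obtain Q where "\<And>i. i \<le> snd s \<Longrightarrow> coeff Q i = coeff (fst s) i" "good (Suc k) Q"
      using extend by blast
    then show "\<exists>s'. (degree (fst s') \<le> snd s' \<and> 0 < snd s' \<and> good (Suc k) (fst s')) \<and>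
      (snd s < snd s' \<and> (\<forall>i\<le>snd s. coeff (fst s') i = coeff (fst s) i))"
      by (intro exI[of _ "(Q, Suc (max (degree Q) (snd s)))"]) auto
  qed
  then obtain s where s: "\<And>k. degree (fst (s k)) \<le> snd (s k)" "\<And>k. 0 < snd (s k)"
    "\<And>k. good k (fst (s k))" "\<And>k. snd (s k) < snd (s (Suc k))"
    "\<And>k i. i \<le> snd (s k) \<Longrightarrow> coeff (fst (s (Suc k))) i = coeff (fst (s k)) i"
    by blast
  define P where "P k = fst (s k)" for k
  define m where "m k = snd (s k)" for k
  have m_mono: "strict_mono m"
    using s(4) by (simp add: m_def strict_mono_Suc_iff)
  have coeff_stable: "coeff (P l) i = coeff (P k) i" if "i \<le> m k" "k \<le> l" for i k l
    using that(2,1)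
  proof (induction l rule: dec_induct)
    case (step l)
    have "m k \<le> m l" using m_mono step.hyps(1) by (simp add: strict_mono_less_eq)
    then show ?case using step s(5)[of i l] by (simp add: P_def m_def)
  qed simp
  \<comment> \<open>A diagonal choice: \<open>j \<le> m j\<close>, so coefficient \<open>j\<close>
    no longer changes from stage \<open>j\<close> on.\<close>
  define a where "a j = coeff (P j) j" for j
  have a_eq: "a j = coeff (P k) j" if "j \<le> m k" for j k
  proof -
    have "j \<le> m j" using m_mono by (rule strict_mono_imp_increasing)
    \<comment> \<open>Either of \<open>j\<close> and \<open>k\<close> may be the larger, so both
      stages are compared with the later one.\<close>
    then have "a j = coeff (P (max j k)) j"
      unfolding a_def by (intro coeff_stable[symmetric]) auto
    also have "\<dots> = coeff (P k) j" using that by (intro coeff_stable) auto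
    finally show ?thesis .
  qed
  have partial_sum: "(\<Sum>j=0..m k. a j * z ^ j) = poly (P k) z" for k z
  proof -
    \<comment> \<open>The cutoff may exceed the degree; the added coefficients vanish.\<close>
    have "poly (P k) z = (\<Sum>j\<le>m k. coeff (P k) j * z ^ j)"
      unfolding poly_altdef using s(1)[of k]
      by (intro sum.mono_neutral_left) (auto simp: P_def m_def coeff_eq_0)
    also have "\<dots> = (\<Sum>j=0..m k. a j * z ^ j)"
      unfolding atMost_atLeast0 by (intro sum.cong) (auto simp: a_eq)
    finally show ?thesis by simp
  qed
  show ?thesis
  proof (intro exI[of _ a] allI impI)
    fix f :: "complex \<Rightarrow> complex" assume f: "continuous_on (sphere 0 1) f"
    \<comment> \<open>For gap \<open>i\<close>, take the stage coding \<open>i\<close> with a target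
      close to \<open>f\<close> on \<open>K i\<close>. The bound \<open>i \<le> k\<close> makes the
      stage's own tolerance \<open>1 / Suc k\<close> at most \<open>1 / Suc i\<close>.\<close>
    have "\<exists>k. i \<le> k \<and> gap k = i \<and> (\<forall>z\<in>K i. norm (poly (target k) z - f z) < 1 / Suc i)" for i
    proof -
      have "continuous_on (K i) f" using f K(2)[of i] by (auto intro: continuous_on_subset)
      then obtain p where p: "\<forall>z\<in>K i. norm (f z - poly p z) < 1 / Suc i / 2"
        using poly_approximable_continuous_on_arc[OF K(1,2)]
        unfolding poly_approximable_def by (metis half_gt_zero of_nat_0_less_iff zero_less_Suc zero_less_divide_1_iff)
      obtain j where j: "\<forall>z\<in>cball 0 1. norm (poly p z - poly (q j) z) < 1 / Suc i / 2"
        using q[of "1 / Suc i / 2" p] by auto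
      have "norm (poly (q j) z - f z) < 1 / Suc i" if "z \<in> K i" for z
      proof -
        have "z \<in> cball 0 1" using that K(2)[of i] by auto
        then have "norm (f z - poly p z) + norm (poly p z - poly (q j) z) < 1 / Suc i / 2 + 1 / Suc i / 2"
          using p j that by (intro add_strict_mono) blast+
        then have "norm ((f z - poly p z) + (poly p z - poly (q j) z)) < 1 / Suc i"
          by (intro norm_triangle_lt) (simp only: field_sum_of_halves)
        then show ?thesis by (simp add: norm_minus_commute)
      qed
      then show ?thesis
        by (intro exI[of _ "prod_encode (i, j)"]) (simp add: gap_def target_def le_prod_encode_1)
    qed
    then obtain k where k: "\<And>i. i \<le> k i" "\<And>i. gap (k i) = i"
      "\<And>i z. z \<in> K i \<Longrightarrow> norm (poly (target (k i)) z - f z) < 1 / Suc i"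
      by metis
    \<comment> \<open>The stages \<open>k i\<close> need not increase with \<open>i\<close>. Jumping
      to \<open>Suc (k i)\<close> forces
      \<open>k (g l) < g (Suc l) \<le> k (g (Suc l))\<close>.\<close>
    define g where "g = rec_nat 0 (\<lambda>_ i. Suc (k i))"
    have g_Suc: "g (Suc l) = Suc (k (g l))" for l by (simp add: g_def)
    have g_mono: "strict_mono g"
      unfolding strict_mono_Suc_iff g_Suc using k(1) by (intro allI le_imp_less_Suc)
    have kg_mono: "strict_mono (\<lambda>l. k (g l))"
      unfolding strict_mono_Suc_iff g_Suc using k(1) by (intro allI Suc_le_lessD)
    have "(\<lambda>l. poly (P (k (g l))) z) \<longlonglongrightarrow> f z" if z: "z \<in> sphere 0 1" for z
    proof -
      \<comment> \<open>Once \<open>z\<close> is outside gap \<open>i\<close>, the stage error and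
        the target error are each at most \<open>1 / Suc i\<close>.\<close>
      have "\<forall>\<^sub>F i in sequentially. norm (poly (P (k i)) z - f z) \<le> 2 * inverse (real (Suc i))"
        using K(3)[OF z]
      proof eventually_elim
        case (elim i)
        have "norm (poly (P (k i)) z - poly (target (k i)) z) < 1 / Suc (k i)"
          using s(3)[of "k i"] elim k(2)[of i] by (simp add: good_def P_def)
        also have "\<dots> \<le> 1 / Suc i" using k(1)[of i] by (simp add: field_simps)
        finally have "norm ((poly (P (k i)) z - poly (target (k i)) z) + (poly (target (k i)) z - f z)) \<le> 2 / Suc i"
          using k(3)[OF elim] by (intro norm_triangle_le) simp
        then show ?case by (simp add: inverse_eq_divide)
      qed
      moreover have "(\<lambda>i. 2 * inverse (real (Suc i))) \<longlonglongrightarrow> 0"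
        using tendsto_mult_left[OF LIMSEQ_inverse_real_of_nat, of 2] by simp
      ultimately have "(\<lambda>i. poly (P (k i)) z) \<longlonglongrightarrow> f z"
        by (rule LIM_zero_cancel[OF Lim_null_comparison])
      from LIMSEQ_subseq_LIMSEQ[OF this g_mono] show ?thesis by (simp add: o_def)
    qed
    moreover have "strict_mono (\<lambda>l. m (k (g l)))"
      using m_mono kg_mono by (simp add: strict_mono_def)
    moreover have "0 < m i" for i using s(2) by (simp add: m_def)
    ultimately show "\<exists>n. strict_mono n \<and> (\<forall>k. 0 < n k) \<and>
        (\<forall>z \<in> sphere 0 1. (\<lambda>k. \<Sum>j=0..n k. a j * z ^ j) \<longlonglongrightarrow> f z)"
      by (intro exI[of _ "\<lambda>l. m (k (g l))"]) (simp add: partial_sum)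
  qed
qed

end
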